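(* For $n\geq 0$, $\mathrm{spa}(n)\equiv 0 \pmod 2$ if and only if $n\equiv 1, 2,$ or $4 \pmod 7$.
   Context: The semi-Padovan sequence $\{\mathrm{spa}(n)\}_{n\ge0}$ is defined recursively by $\mathrm{spa}(0)=1$, $\mathrm{spa}(1)=0$, and for $n\ge1$: $\mathrm{spa}(2n)=\mathrm{spa}(n)$ and $\mathrm{spa}(2n+1)=\mathrm{spa}(2n-1)+\mathrm{spa}(2n-2)$. *)

theory Defs
  imports Main "HOL-Number_Theory.Cong"
begin

text \<open>The semi-Padovan sequence. In the last equation \<open>n \<ge> 1\<close>, so neither subtraction truncates.\<close>

function spa :: "nat \<Rightarrow> nat" where
  "spa 0 = 1"
| "spa 1 = 0"
| "n \<ge> 1 \<Longrightarrow> spa (2 * n) = spa n"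
| "n \<ge> 1 \<Longrightarrow> spa (2 * n + 1) = spa (2 * n - 1) + spa (2 * n - 2)"
proof -
  fix P :: bool and x :: nat
  assume zero: "x = 0 \<Longrightarrow> P" and one: "x = 1 \<Longrightarrow> P"
    and ev: "\<And>n. \<lbrakk>n \<ge> 1; x = 2 * n\<rbrakk> \<Longrightarrow> P"
    and od: "\<And>n. \<lbrakk>n \<ge> 1; x = 2 * n + 1\<rbrakk> \<Longrightarrow> P"
  consider "x = 0" | "x = 1" | "x div 2 \<ge> 1" "x = 2 * (x div 2)"
    | "x div 2 \<ge> 1" "x = 2 * (x div 2) + 1"
    by linarith
  then show P
    by cases (use zero one ev od in blast)+
qed (presburger | simp)+

termination
  by (relation "measure id") auto

end

theory Submission
  imports Defs
begin

text \<open>Let \<open>E\<close> be the set of \<open>n\<close> with \<open>n mod 7 \<in> {1, 2, 4}\<close>. The indicator of its complement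
  has period \<open>1, 0, 0, 1, 0, 1, 1\<close>, which is the sequence over the field with two elements given by
  \<open>f (m + 3) = f (m + 1) + f m\<close>: the odd-index rule for \<^term>\<open>spa\<close> is this recurrence with
  \<open>m = 2 * n - 2\<close>. The even-index rule is respected as well, because \<open>{1, 2, 4}\<close> is the subgroup of
  the units modulo 7 generated by 2, so that doubling preserves \<open>E\<close> and its complement. Hence
  the parity of \<^term>\<open>spa\<close> and the indicator obey the same recursion, with the same
  values 1, 0 at the arguments 0, 1.\<close>

definition even_residue :: "nat \<Rightarrow> bool" where
  "even_residue n \<longleftrightarrow> n mod 7 \<in> {1, 2, 4}"

lemma residue_mod_7_cases:
  fixes n :: nat
  shows "n mod 7 \<in> {0, 1, 2, 3, 4, 5, 6}"
  by (simp, presburger)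

lemma even_residue_double: "even_residue (2 * n) \<longleftrightarrow> even_residue n"
proof -
  have "(2 * n) mod 7 = (2 * (n mod 7)) mod 7"
    by (simp add: mod_mult_right_eq)
  then show ?thesis
    using residue_mod_7_cases[of n] by (auto simp: even_residue_def)
qed

text \<open>The equivalence on the right says that \<open>f (m + 1) + f m\<close> vanishes modulo 2, for \<open>f\<close> the
  indicator of the complement.\<close>

lemma even_residue_add_3:
  "even_residue (m + 3) \<longleftrightarrow> (even_residue (m + 1) \<longleftrightarrow> even_residue m)"
proof -
  have "(m + 3) mod 7 = (m mod 7 + 3) mod 7" "(m + 1) mod 7 = (m mod 7 + 1) mod 7"
    by (simp_all only: mod_add_left_eq)
  then show ?thesis
    using residue_mod_7_cases[of m] by (auto simp: even_residue_def)
qed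

lemma even_spa_iff: "even (spa n) \<longleftrightarrow> even_residue n"
proof (induction n rule: spa.induct)
  case 1
  show ?case by (simp add: even_residue_def)
next
  case 2
  show ?case by (simp add: even_residue_def flip: One_nat_def)
next
  case (3 n)
  then show ?case by (simp add: even_residue_double)
next
  case (4 n)
  define m where "m = 2 * n - 2"
  have idx: "2 * n - 1 = m + 1" "2 * n + 1 = m + 3"
    using \<open>n \<ge> 1\<close> by (simp_all add: m_def)
  have "spa (m + 3) = spa (m + 1) + spa m"
    using spa.simps(4)[OF \<open>n \<ge> 1\<close>] by (simp only: idx flip: m_def)
  moreover have "even (spa (m + 1)) \<longleftrightarrow> even_residue (m + 1)"
    and "even (spa m) \<longleftrightarrow> even_residue m"
    using 4 by (simp_all only: idx flip: m_def)
  ultimately show ?case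
    by (simp only: idx even_add even_residue_add_3)
qed

theorem theorem5p6:
  fixes n :: nat
  shows "[spa n = 0] (mod 2) \<longleftrightarrow> [n = 1] (mod 7) \<or> [n = 2] (mod 7) \<or> [n = 4] (mod 7)"
proof -
  have "[spa n = 0] (mod 2) \<longleftrightarrow> even (spa n)"
    by (rule cong_0_iff)
  then show ?thesis
    by (simp add: even_spa_iff even_residue_def cong_def)
qed

end
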